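(* Let $\alpha(u)=(u,f_1(u),f_2(u))$ be a smooth space curve in the Galilean space $\mathbb{G}_3$ and let $\beta(v)=(0,g_1(v),g_2(v))$ be a smooth isotropic curve with $(g_1')^2+(g_2')^2=1$, both defined on open intervals. If the translation surface $$r(u,v)=\alpha(u)+\beta(v)=\bigl(u,\;f_1(u)+g_1(v),\;f_2(u)+g_2(v)\bigr)$$ has constant Gaussian curvature $K_0$, then it is a generalized cylinder with isotropic rulings (and $K_0=0$).
   Context: The affine model of the Galilean 3-space $\mathbb{G}_3$ is $\mathbb{R}^3$ with coordinates $(x,y,z)$. A vector is isotropic if its first component is $0$. A curve $\alpha(u)=(u,f_1(u),f_2(u))$ is a space curve if its torsion is nowhere zero, i.e. $f_1''f_2'''-f_1'''f_2''\neq 0$ at every $u$. Curvatures of a surface $r(u_1,u_2)=(x,y,z)$ (with $x_{,i}=\partial x/\partial u_i$, $x_{,ij}=\partial^2x/\partial u_i\partial u_j$, etc.): put $g_i=x_{,i}$ (not to be confused with the component functions of $\beta$), assume $x_{,i}\ne 0$ for some $i$ at each point (admissibility), and set $$W=\sqrt{(x_{,1}z_{,2}-x_{,2}z_{,1})^2+(x_{,2}y_{,1}-x_{,1}y_{,2})^2}>0,\qquad N=\tfrac1W\bigl(0,\,-x_{,1}z_{,2}+x_{,2}z_{,1},\,x_{,1}y_{,2}-x_{,2}y_{,1}\bigr),$$ $$L_{ij}=\tfrac1{x_{,k}}\bigl(x_{,k}(0,y_{,ij},z_{,ij})-x_{,ij}(0,y_{,k},z_{,k})\bigr)\cdot N$$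 for an index $k$ with $x_{,k}\neq 0$, where $\cdot$ is the Euclidean scalar product. The Gaussian curvature is $K=(L_{11}L_{22}-L_{12}^2)/W^2$. A generalized cylinder (cylindrical surface) is a surface that can be parameterized as $\gamma(t)+\lambda e$ with $\gamma$ a curve and $e\neq 0$ a constant vector; its rulings are isotropic if $e$ is isotropic. *)

theory Defs
  imports "HOL-Analysis.Analysis"
begin

text \<open>Intervals may be unbounded.\<close>
definition open_interval :: "real set \<Rightarrow> bool" where
  "open_interval I \<longleftrightarrow> open I \<and> is_interval I \<and> I \<noteq> {}"

text \<open>Class \<open>C\<^sup>k\<close> and class \<open>C\<^sup>\<infinity>\<close>; used on open sets only.\<close>
primrec Ck_on :: "nat \<Rightarrow> 'a::real_normed_vector set \<Rightarrow> ('a \<Rightarrow> 'b::real_normed_vector) \<Rightarrow> bool" where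
  "Ck_on 0 S f \<longleftrightarrow> continuous_on S f"
| "Ck_on (Suc k) S f \<longleftrightarrow> (\<forall>x\<in>S. f differentiable (at x)) \<and>
     (\<forall>w. Ck_on k S (\<lambda>x. frechet_derivative f (at x) w))"

definition smooth_on :: "'a::real_normed_vector set \<Rightarrow> ('a \<Rightarrow> 'b::real_normed_vector) \<Rightarrow> bool" where
  "smooth_on S f \<longleftrightarrow> (\<forall>k. Ck_on k S f)"

text \<open>The ambient space is the affine model of the Galilean 3-space: \<open>real^3\<close> with
  coordinates \<open>x = _ $ 1\<close>, \<open>y = _ $ 2\<close>, \<open>z = _ $ 3\<close>. Parameters of surfaces are points of \<open>real^2\<close>.\<close>

definition isotropic :: "real^3 \<Rightarrow> bool" where
  "isotropic w \<longleftrightarrow> w $ 1 = 0"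

text \<open>Nonvanishing torsion of the curve \<open>(u, f1 u, f2 u)\<close>.\<close>
definition space_curve_on :: "real set \<Rightarrow> (real \<Rightarrow> real) \<Rightarrow> (real \<Rightarrow> real) \<Rightarrow> bool" where
  "space_curve_on I f1 f2 \<longleftrightarrow>
     (\<forall>u\<in>I. (deriv ^^ 2) f1 u * (deriv ^^ 3) f2 u - (deriv ^^ 3) f1 u * (deriv ^^ 2) f2 u \<noteq> 0)"

definition pd :: "2 \<Rightarrow> (real^2 \<Rightarrow> real) \<Rightarrow> real^2 \<Rightarrow> real" where
  "pd i F p = deriv (\<lambda>t. F (p + t *\<^sub>R axis i 1)) 0"

text \<open>First and second partial derivatives of the \<open>c\<close>-th coordinate of a surface.\<close>
definition D1 :: "(real^2 \<Rightarrow> real^3) \<Rightarrow> 3 \<Rightarrow> 2 \<Rightarrow> real^2 \<Rightarrow> real" where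
  "D1 r c i = pd i (\<lambda>q. r q $ c)"

definition D2 :: "(real^2 \<Rightarrow> real^3) \<Rightarrow> 3 \<Rightarrow> 2 \<Rightarrow> 2 \<Rightarrow> real^2 \<Rightarrow> real" where
  "D2 r c i j = pd i (pd j (\<lambda>q. r q $ c))"

definition gal_W :: "(real^2 \<Rightarrow> real^3) \<Rightarrow> real^2 \<Rightarrow> real" where
  "gal_W r p = sqrt ((D1 r 1 1 p * D1 r 3 2 p - D1 r 1 2 p * D1 r 3 1 p)\<^sup>2
                   + (D1 r 1 2 p * D1 r 2 1 p - D1 r 1 1 p * D1 r 2 2 p)\<^sup>2)"

definition gal_normal :: "(real^2 \<Rightarrow> real^3) \<Rightarrow> real^2 \<Rightarrow> real^3" where
  "gal_normal r p = (1 / gal_W r p) *\<^sub>R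
     vector [0,
             - D1 r 1 1 p * D1 r 3 2 p + D1 r 1 2 p * D1 r 3 1 p,
             D1 r 1 1 p * D1 r 2 2 p - D1 r 1 2 p * D1 r 2 1 p]"

definition gal_L_wrt :: "2 \<Rightarrow> (real^2 \<Rightarrow> real^3) \<Rightarrow> 2 \<Rightarrow> 2 \<Rightarrow> real^2 \<Rightarrow> real" where
  "gal_L_wrt k r i j p = ((1 / D1 r 1 k p) *\<^sub>R
     (D1 r 1 k p *\<^sub>R (vector [0, D2 r 2 i j p, D2 r 3 i j p] :: real^3)
      - D2 r 1 i j p *\<^sub>R vector [0, D1 r 2 k p, D1 r 3 k p])) \<bullet> gal_normal r p"

text \<open>The index \<open>k\<close> only has to satisfy \<open>x\<^sub>,\<^sub>k \<noteq> 0\<close>; lemma \<open>gal_L_wrt_indep\<close> shows that the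
  choice is immaterial. Meaningful at admissible points only.\<close>
definition gal_L :: "(real^2 \<Rightarrow> real^3) \<Rightarrow> 2 \<Rightarrow> 2 \<Rightarrow> real^2 \<Rightarrow> real" where
  "gal_L r i j p = gal_L_wrt (SOME k. D1 r 1 k p \<noteq> 0) r i j p"

definition gauss_curvature :: "(real^2 \<Rightarrow> real^3) \<Rightarrow> real^2 \<Rightarrow> real" where
  "gauss_curvature r p =
     (gal_L r 1 1 p * gal_L r 2 2 p - (gal_L r 1 2 p)\<^sup>2) / (gal_W r p)\<^sup>2"

lemma gal_L_wrt_indep:
  assumes "D1 r 1 k p \<noteq> 0" "D1 r 1 l p \<noteq> 0"
  shows "gal_L_wrt k r i j p = gal_L_wrt l r i j p"
proof -
  have *: "gal_L_wrt 1 r i j p = gal_L_wrt 2 r i j p"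
    if "D1 r 1 1 p \<noteq> 0" "D1 r 1 2 p \<noteq> 0"
  proof (cases "gal_W r p = 0")
    case True
    then show ?thesis by (simp add: gal_L_wrt_def gal_normal_def)
  next
    case False
    with that show ?thesis
      by (simp add: gal_L_wrt_def gal_normal_def inner_vec_def sum_3 field_simps)
  qed
  show ?thesis
    using exhaust_2[of k] exhaust_2[of l] assms * by auto
qed

definition param_domain :: "real set \<Rightarrow> real set \<Rightarrow> (real^2) set" where
  "param_domain I J = {p. p $ 1 \<in> I \<and> p $ 2 \<in> J}"

definition translation_surface :: "(real \<Rightarrow> real^3) \<Rightarrow> (real \<Rightarrow> real^3) \<Rightarrow> real^2 \<Rightarrow> real^3" where
  "translation_surface \<alpha> \<beta> p = \<alpha> (p $ 1) + \<beta> (p $ 2)"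

text \<open>The surface \<open>r\<close>, defined on \<open>D\<close>, can be parameterized as \<open>\<gamma> t + \<lambda> *\<^sub>R e\<close>: this is meant as a
  reparameterization of \<open>r\<close> by a diffeomorphism \<open>\<phi>\<close> (with inverse \<open>\<psi>\<close>) of the parameter domains,
  where the parameters \<open>t\<close> and \<open>\<lambda>\<close> range over open intervals.\<close>
definition cylinder_with_ruling :: "(real^2 \<Rightarrow> real^3) \<Rightarrow> (real^2) set \<Rightarrow> real^3 \<Rightarrow> bool" where
  "cylinder_with_ruling r D e \<longleftrightarrow> e \<noteq> 0 \<and>
     (\<exists>T \<Lambda> \<gamma> \<phi> \<psi>. open_interval T \<and> open_interval \<Lambda> \<and> smooth_on T \<gamma> \<and>
        homeomorphism (param_domain T \<Lambda>) D \<phi> \<psi> \<and>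
        smooth_on (param_domain T \<Lambda>) \<phi> \<and> smooth_on D \<psi> \<and>
        (\<forall>q\<in>param_domain T \<Lambda>. r (\<phi> q) = \<gamma> (q $ 1) + (q $ 2) *\<^sub>R e))"

definition generalized_cylinder_isotropic_rulings :: "(real^2 \<Rightarrow> real^3) \<Rightarrow> (real^2) set \<Rightarrow> bool" where
  "generalized_cylinder_isotropic_rulings r D \<longleftrightarrow>
     (\<exists>e. isotropic e \<and> cylinder_with_ruling r D e)"

end

(* The surface has L11 = det(\<beta>', \<alpha>''), L12 = 0, L22 = det(\<beta>', \<beta>'') and W = 1, where the determinants
   are taken in the isotropic plane, so that K = L11 L22. If L22 did not vanish at some v0, then
   differentiating K = K0 in u would give det(\<beta>', \<alpha>''') = 0 near v0, and differentiating this in v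
   would make \<alpha>''' parallel to both \<beta>' and \<beta>'' at v0. As these are independent, \<alpha>''' = 0, which
   contradicts the nonvanishing torsion. Hence K0 = 0 and \<beta>'' is parallel to the unit vector \<beta>',
   to which it is also orthogonal; so \<beta>'' = 0 and \<beta> is a straight line. *)
theory Submission
  imports Defs
begin

section \<open>Smooth functions\<close>

text \<open>A derivative at a point of an open set depends only on nearby values. This lets a
  derivative be replaced by a formula that is valid only on \<open>S\<close>.\<close>

lemma Ck_on_cong:
  assumes "open S" "\<And>x. x \<in> S \<Longrightarrow> f x = g x" "Ck_on k S f"
  shows "Ck_on k S g"
  using assms(2,3)
proof (induction k arbitrary: f g)
  case 0
  then show ?case by (simp cong: continuous_on_cong)
next
  case (Suc k)
  have der: "(f has_derivative D) (at x) \<longleftrightarrow> (g has_derivative D) (at x)" if "x \<in> S" for x D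
    using has_derivative_transform_within_open[OF _ assms(1) that] Suc.prems(1) by metis
  have "frechet_derivative f (at x) = frechet_derivative g (at x)" if "x \<in> S" for x
    unfolding frechet_derivative_def using der[OF that] by simp
  then have "Ck_on k S (\<lambda>x. frechet_derivative g (at x) w)" for w
    using Suc.IH[of "\<lambda>x. frechet_derivative f (at x) w"] Suc.prems(2) by simp
  moreover have "g differentiable at x" if "x \<in> S" for x
  proof -
    have "f differentiable at x" using Suc.prems(2) that by simp
    then show ?thesis unfolding differentiable_def der[OF that] .
  qed
  ultimately show ?case by simp
qed

text \<open>A bounded linear map commutes with differentiation, so every derivative of the
  composition is again \<open>h\<close> after a derivative of \<open>f\<close>. The case of interest
  is a coordinate projection.\<close>

lemma Ck_on_bounded_linear:
  assumes "bounded_linear h" "open S" "Ck_on k S f"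
  shows "Ck_on k S (\<lambda>x. h (f x))"
  using assms(3)
proof (induction k arbitrary: f)
  case 0
  then show ?case by (simp add: bounded_linear.continuous_on[OF assms(1)])
next
  case (Suc k)
  have der: "((\<lambda>x. h (f x)) has_derivative (\<lambda>w. h (frechet_derivative f (at x) w))) (at x)"
    if "x \<in> S" for x
    using Suc.prems that
    by (auto intro!: bounded_linear.has_derivative[OF assms(1)] simp: frechet_derivative_works)
  have "Ck_on k S (\<lambda>x. frechet_derivative (\<lambda>x. h (f x)) (at x) w)" for w
  proof (rule Ck_on_cong[OF assms(2)])
    show "Ck_on k S (\<lambda>x. h (frechet_derivative f (at x) w))"
      using Suc by simp
    show "h (frechet_derivative f (at x) w) = frechet_derivative (\<lambda>x. h (f x)) (at x) w"
      if "x \<in> S" for x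
      using frechet_derivative_at[OF der[OF that]] by metis
  qed
  then show ?case
    using der by (auto intro: differentiableI)
qed

lemma Ck_on_const: "Ck_on k S (\<lambda>x. c)"
  by (induction k arbitrary: c) (simp_all add: frechet_derivative_const)

lemma smooth_on_ident: "smooth_on S (\<lambda>x. x)"
  unfolding smooth_on_def
proof
  fix k show "Ck_on k S (\<lambda>x. x)"
    by (cases k) (simp_all add: Ck_on_const frechet_derivative_ident)
qed

lemma smooth_on_add_const:
  assumes "smooth_on S f"
  shows "smooth_on S (\<lambda>x. f x + c)"
  unfolding smooth_on_def
proof
  fix k
  \<comment> \<open>Adding \<open>- c\<close> gives the converse direction. As both functions have
    the same derivatives, every positive \<open>k\<close> is settled without induction.\<close>
  have iff: "((\<lambda>x. f x + c) has_derivative D) F \<longleftrightarrow> (f has_derivative D) F" for D F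
    using has_derivative_add_const[of f D F c] has_derivative_add_const[of "\<lambda>x. f x + c" D F "- c"]
    by auto
  show "Ck_on k S (\<lambda>x. f x + c)"
    using assms unfolding smooth_on_def
    by (cases k) (auto intro!: continuous_intros simp: iff differentiable_def frechet_derivative_def
        dest: spec[of _ k])
qed

text \<open>A bridge from Frechet derivatives to \<open>deriv\<close>, which is the derivative in
  direction 1. The first part can be iterated to reach derivatives of higher order.\<close>

lemma smooth_on_real_deriv:
  fixes f :: "real \<Rightarrow> real"
  assumes "open S" "smooth_on S f"
  shows "smooth_on S (deriv f)" and "x \<in> S \<Longrightarrow> (f has_real_derivative deriv f x) (at x)"
proof -
  have Ck: "Ck_on (Suc k) S f" for k
    using assms(2) unfolding smooth_on_def by blast
  have der: "(f has_real_derivative deriv f x) (at x)" if "x \<in> S" for x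
    using Ck[of 0] that DERIV_deriv_iff_real_differentiable by simp
  then show "x \<in> S \<Longrightarrow> (f has_real_derivative deriv f x) (at x)" .
  have "frechet_derivative f (at x) 1 = deriv f x" if "x \<in> S" for x
    using frechet_derivative_at[OF der[OF that, unfolded has_field_derivative_def]]
    by (metis mult.right_neutral)
  then show "smooth_on S (deriv f)"
    using Ck_on_cong[OF assms(1), of "\<lambda>x. frechet_derivative f (at x) 1"] Ck
    unfolding smooth_on_def by simp
qed

lemma smooth_on_nth:
  fixes f :: "real \<Rightarrow> real^'n"
  assumes "open S" "smooth_on S f"
  shows "smooth_on S (\<lambda>x. f x $ i)"
  using Ck_on_bounded_linear[OF bounded_linear_vec_nth assms(1)] assms(2)
  unfolding smooth_on_def by blast

lemma has_real_derivative_zero_const_on_interval: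
  fixes f :: "real \<Rightarrow> real"
  assumes "open_interval J" "\<And>x. x \<in> J \<Longrightarrow> (f has_real_derivative 0) (at x)" "a \<in> J" "b \<in> J"
  shows "f a = f b"
  using has_field_derivative_zero_constant[of J f] assms
  by (metis at_within_open open_interval_def is_interval_convex)

section \<open>Curvature of a translation surface\<close>

text \<open>Along a coordinate axis, a sum of one-variable functions is a translate of one summand
  plus a constant. Both sides admit the same derivatives, so the values of \<open>deriv\<close>
  agree even where none exists.\<close>

lemma deriv_shift_add_const:
  "deriv (\<lambda>t. F (x + t) + c) 0 = deriv F (x::real)"
proof -
  have "((\<lambda>t. F (x + t) + c) has_real_derivative D) (at 0) \<longleftrightarrow> (F has_real_derivative D) (at x)" for D
  proof -
    have "((\<lambda>t. F (x + t) + c) has_real_derivative D) (at 0)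
        \<longleftrightarrow> ((\<lambda>t. F (x + t)) has_real_derivative D) (at 0)"
      using DERIV_add[OF _ DERIV_const[of c], of "\<lambda>t. F (x + t)" D 0 UNIV]
        DERIV_add[OF _ DERIV_const[of "-c"], of "\<lambda>t. F (x + t) + c" D 0 UNIV] by auto
    then show ?thesis
      using DERIV_shift[of F D 0 x] by (simp add: add.commute)
  qed
  then show ?thesis unfolding deriv_def by simp
qed

lemma pd_separated:
  fixes F G :: "real \<Rightarrow> real"
  shows "pd 1 (\<lambda>q. F (q $ 1) + G (q $ 2)) p = deriv F (p $ 1)"
    and "pd 2 (\<lambda>q. F (q $ 1) + G (q $ 2)) p = deriv G (p $ 2)"
  unfolding pd_def
  using deriv_shift_add_const[of F "p $ 1" "G (p $ 2)"] deriv_shift_add_const[of G "p $ 2" "F (p $ 1)"]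
  by (simp_all add: axis_def add.commute)

text \<open>Each coordinate is a function of u plus a function of v, so the mixed second derivatives
  vanish; all second derivatives of x = u vanish too. With unit speed the normal is (0, -g2', g1'),
  and the two factors are L11 and L22.\<close>

lemma gauss_curvature_translation_surface:
  fixes f1 f2 g1 g2 :: "real \<Rightarrow> real"
  defines "r \<equiv> translation_surface (\<lambda>u. vector [u, f1 u, f2 u]) (\<lambda>v. vector [0, g1 v, g2 v])"
  assumes "(deriv g1 (p $ 2))\<^sup>2 + (deriv g2 (p $ 2))\<^sup>2 = 1"
  shows "gauss_curvature r p =
    (deriv (deriv f2) (p $ 1) * deriv g1 (p $ 2) - deriv (deriv f1) (p $ 1) * deriv g2 (p $ 2)) *
    (deriv (deriv g2) (p $ 2) * deriv g1 (p $ 2) - deriv (deriv g1) (p $ 2) * deriv g2 (p $ 2))"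
proof -
  have r: "(\<lambda>q. r q $ 1) = (\<lambda>q. (\<lambda>u. u) (q $ 1) + (\<lambda>v. 0) (q $ 2))"
    "(\<lambda>q. r q $ 2) = (\<lambda>q. f1 (q $ 1) + g1 (q $ 2))"
    "(\<lambda>q. r q $ 3) = (\<lambda>q. f2 (q $ 1) + g2 (q $ 2))"
    by (auto simp: r_def translation_surface_def)
  have D1: "D1 r 1 1 = (\<lambda>q. 1)" "D1 r 1 2 = (\<lambda>q. 0)"
    "D1 r 2 1 = (\<lambda>q. deriv f1 (q $ 1))" "D1 r 2 2 = (\<lambda>q. deriv g1 (q $ 2))"
    "D1 r 3 1 = (\<lambda>q. deriv f2 (q $ 1))" "D1 r 3 2 = (\<lambda>q. deriv g2 (q $ 2))"
    unfolding D1_def r by (rule ext, subst pd_separated, simp)+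
  have pd_fst: "pd 1 (\<lambda>q. F (q $ 1)) p = deriv F (p $ 1)" "pd 2 (\<lambda>q. F (q $ 1)) p = 0"
    and pd_snd: "pd 1 (\<lambda>q. F (q $ 2)) p = 0" "pd 2 (\<lambda>q. F (q $ 2)) p = deriv F (p $ 2)"
    for F :: "real \<Rightarrow> real"
    using pd_separated[of F "\<lambda>v. 0" p] pd_separated[of "\<lambda>u. 0" F p] by simp_all
  have pd_const: "pd i (\<lambda>q. c) p = 0" for i c
    by (simp add: pd_def)
  have D2: "D2 r c i j p = pd i (D1 r c j) p" for c i j
    by (simp add: D2_def D1_def)
  \<comment> \<open>As x = u does not depend on v, the index 1 is the only admissible
    choice.\<close>
  have k: "(SOME k. D1 r 1 k p \<noteq> 0) = 1"
  proof (rule some_equality)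
    show "D1 r 1 1 p \<noteq> 0" by (simp add: D1)
    show "k = 1" if "D1 r 1 k p \<noteq> 0" for k
      using exhaust_2[of k] that D1(2) by auto
  qed
  have W: "gal_W r p = 1"
    using assms(2) by (simp add: gal_W_def D1 add.commute)
  have L: "gal_L r i j p = D2 r 3 i j p * deriv g1 (p $ 2) - D2 r 2 i j p * deriv g2 (p $ 2)"
    if "D2 r 1 i j p = 0" for i j
    unfolding gal_L_def k gal_L_wrt_def gal_normal_def W that
    by (simp add: D1 inner_vec_def sum_3)
  show ?thesis
    unfolding gauss_curvature_def W
    by (simp add: L D2 D1 pd_fst pd_snd pd_const)
qed

section \<open>Rigidity\<close>

text \<open>Cramer's rule for a homogeneous system in \<open>a\<close> and \<open>b\<close>. It is
  meant for (a, b) = \<alpha>''' at one point and p, q = \<beta>', \<beta>''.\<close>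

lemma parallel_to_independent_imp_zero:
  fixes a b :: "'a::idom"
  assumes "b * p1 = a * p2" "b * q1 = a * q2" "q2 * p1 - q1 * p2 \<noteq> 0"
  shows "a = 0 \<and> b = 0"
proof -
  have "a * (q2 * p1 - q1 * p2) = 0" "b * (q2 * p1 - q1 * p2) = 0"
    using assms(1,2) by algebra+
  then show ?thesis using assms(3) by simp
qed

theorem theorem4p1:
  fixes f1 f2 g1 g2 :: "real \<Rightarrow> real"
    and \<alpha> \<beta> :: "real \<Rightarrow> real^3"
    and r :: "real^2 \<Rightarrow> real^3"
    and I J :: "real set" and K0 :: real
  defines "\<alpha> \<equiv> (\<lambda>u. vector [u, f1 u, f2 u])"
    and "\<beta> \<equiv> (\<lambda>v. vector [0, g1 v, g2 v])"
    and "r \<equiv> translation_surface \<alpha> \<beta>"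
  assumes "open_interval I" and "open_interval J"
    and "smooth_on I \<alpha>" and "space_curve_on I f1 f2"
    and "smooth_on J \<beta>" and "\<And>v. v \<in> J \<Longrightarrow> (deriv g1 v)\<^sup>2 + (deriv g2 v)\<^sup>2 = 1"
    and "\<And>p. p \<in> param_domain I J \<Longrightarrow> gauss_curvature r p = K0"
  shows "generalized_cylinder_isotropic_rulings r (param_domain I J) \<and> K0 = 0"
proof -
  have openI: "open I" and openJ: "open J"
    using assms(4,5) by (auto simp: open_interval_def)
  obtain u0 v0 where u0: "u0 \<in> I" and v0: "v0 \<in> J"
    using assms(4,5) by (auto simp: open_interval_def)
  have sf: "smooth_on I f1" "smooth_on I f2"
    using smooth_on_nth[OF openI assms(6), of 2] smooth_on_nth[OF openI assms(6), of 3]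
    by (simp_all add: \<alpha>_def)
  have sg: "smooth_on J g1" "smooth_on J g2"
    using smooth_on_nth[OF openJ assms(8), of 2] smooth_on_nth[OF openJ assms(8), of 3]
    by (simp_all add: \<beta>_def)
  note df = smooth_on_real_deriv(2)[OF openI] and sdf = smooth_on_real_deriv(1)[OF openI]
  note dg = smooth_on_real_deriv(2)[OF openJ] and sdg = smooth_on_real_deriv(1)[OF openJ]
  note dg1 = dg[OF sg(1)] dg[OF sg(2)] and dg2 = dg[OF sdg[OF sg(1)]] dg[OF sdg[OF sg(2)]]
  \<comment> \<open>The determinant of \<beta>' and \<beta>'', that is, the signed curvature of the
    unit-speed curve \<beta> in the isotropic plane.\<close>
  define \<kappa> where "\<kappa> v = deriv (deriv g2) v * deriv g1 v - deriv (deriv g1) v * deriv g2 v" for v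
  have K: "(deriv (deriv f2) u * deriv g1 v - deriv (deriv f1) u * deriv g2 v) * \<kappa> v = K0"
    if "u \<in> I" "v \<in> J" for u v
    using assms(10)[of "vector [u, v]"]
      gauss_curvature_translation_surface[of g1 "vector [u, v]" g2 f1 f2] assms(9)[OF that(2)] that
    by (simp add: r_def \<alpha>_def \<beta>_def param_domain_def \<kappa>_def)
  have \<kappa>0: "\<kappa> v = 0" if v: "v \<in> J" for v
  proof (rule ccontr)
    assume nz: "\<kappa> v \<noteq> 0"
    let ?a = "deriv (deriv (deriv f1)) u0" and ?b = "deriv (deriv (deriv f2)) u0"
    \<comment> \<open>For fixed \<open>w\<close> the first factor in \<open>K\<close> is the
      constant \<open>K0 / \<kappa> w\<close> in u, so its u-derivative at \<open>u0\<close>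
      vanishes.\<close>
    have par: "?b * deriv g1 w = ?a * deriv g2 w" if w: "w \<in> J" "\<kappa> w \<noteq> 0" for w
    proof -
      have "((\<lambda>u. deriv (deriv f2) u * deriv g1 w - deriv (deriv f1) u * deriv g2 w)
          has_real_derivative ?b * deriv g1 w - ?a * deriv g2 w) (at u0)"
        using df[OF sdf[OF sdf[OF sf(1)]] u0] df[OF sdf[OF sdf[OF sf(2)]] u0]
        by (auto intro!: derivative_eq_intros)
      moreover have "((\<lambda>u. deriv (deriv f2) u * deriv g1 w - deriv (deriv f1) u * deriv g2 w)
          has_real_derivative 0) (at u0)"
      proof (rule has_field_derivative_transform_within_open[OF DERIV_const openI u0])
        show "K0 / \<kappa> w = deriv (deriv f2) u * deriv g1 w - deriv (deriv f1) u * deriv g2 w"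
          if "u \<in> I" for u
          using K[OF that w(1)] w(2) by (simp add: field_simps)
      qed
      ultimately show ?thesis using DERIV_unique by fastforce
    qed
    \<comment> \<open>Differentiating \<open>par\<close> in v requires it on a neighbourhood of
      \<open>v\<close>; continuity of \<kappa> provides the open set \<open>S\<close>.\<close>
    have cont: "continuous_on J \<kappa>"
      unfolding \<kappa>_def
      using dg2 dg[OF sdg[OF sdg[OF sg(1)]]] dg[OF sdg[OF sdg[OF sg(2)]]]
      by (intro continuous_intros; meson DERIV_isCont continuous_at_imp_continuous_on)
    define S where "S = J \<inter> \<kappa> -` (- {0})"
    have S: "open S" "v \<in> S"
      using continuous_open_preimage[OF cont openJ] v nz by (auto simp: S_def open_Compl)
    have "((\<lambda>w. ?b * deriv g1 w - ?a * deriv g2 w) has_real_derivative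
        ?b * deriv (deriv g1) v - ?a * deriv (deriv g2) v) (at v)"
      using dg2[OF v] by (auto intro!: derivative_eq_intros)
    moreover have "((\<lambda>w. ?b * deriv g1 w - ?a * deriv g2 w) has_real_derivative 0) (at v)"
      by (rule has_field_derivative_transform_within_open[OF DERIV_const S, of 0])
        (auto simp: S_def par)
    ultimately have "?b * deriv (deriv g1) v = ?a * deriv (deriv g2) v"
      using DERIV_unique by fastforce
    then have "?a = 0 \<and> ?b = 0"
      using parallel_to_independent_imp_zero[OF par[OF v nz]] nz by (simp add: \<kappa>_def)
    \<comment> \<open>Both terms of the torsion expression at \<open>u0\<close> contain a component
      of \<alpha>'''.\<close>
    then show False
      using assms(7) u0 by (auto simp: space_curve_on_def numeral_2_eq_2 numeral_3_eq_3)
  qed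
  have K0: "K0 = 0"
    using K[OF u0 v0] \<kappa>0[OF v0] by simp
  have dd0: "deriv (deriv g1) v = 0 \<and> deriv (deriv g2) v = 0" if v: "v \<in> J" for v
  proof -
    have "((\<lambda>v. (deriv g1 v)\<^sup>2 + (deriv g2 v)\<^sup>2) has_real_derivative
       2 * deriv g1 v * deriv (deriv g1) v + 2 * deriv g2 v * deriv (deriv g2) v) (at v)"
      using dg2[OF v] by (auto intro!: derivative_eq_intros)
    moreover have "((\<lambda>v. (deriv g1 v)\<^sup>2 + (deriv g2 v)\<^sup>2) has_real_derivative 0) (at v)"
      by (rule has_field_derivative_transform_within_open[OF DERIV_const openJ v, of 1])
        (simp add: assms(9))
    ultimately have orth: "deriv g1 v * deriv (deriv g1) v = - deriv g2 v * deriv (deriv g2) v"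
      using DERIV_unique by fastforce
    have par: "deriv g1 v * deriv (deriv g2) v = deriv g2 v * deriv (deriv g1) v"
      using \<kappa>0[OF v] by (simp add: \<kappa>_def mult.commute)
    \<comment> \<open>Multiplying g1'' by (g1')^2 + (g2')^2 = 1 and substituting \<open>orth\<close>
      and \<open>par\<close> makes the terms cancel; likewise for g2''.\<close>
    from orth par assms(9)[OF v] have "deriv (deriv g1) v = 0" "deriv (deriv g2) v = 0"
      by algebra+
    then show ?thesis by simp
  qed
  define e1 e2 where "e1 = deriv g1 v0" and "e2 = deriv g2 v0"
  have const: "deriv g1 v = e1" "deriv g2 v = e2" if "v \<in> J" for v
    unfolding e1_def e2_def
    using has_real_derivative_zero_const_on_interval[OF assms(5) _ that v0] dg2 dd0 by metis+
  have line: "g v = (g v0 - c * v0) + c * v"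
    if "v \<in> J" "\<And>w. w \<in> J \<Longrightarrow> (g has_real_derivative c) (at w)" for g v c
  proof -
    have "g v - c * v = g v0 - c * v0"
      by (rule has_real_derivative_zero_const_on_interval[OF assms(5) _ that(1) v0])
        (auto intro!: derivative_eq_intros that(2))
    then show ?thesis by simp
  qed
  define e :: "real^3" where "e = vector [0, e1, e2]"
  \<comment> \<open>The point that the line carrying \<beta> would reach at parameter 0, which need
    not lie in \<open>J\<close>.\<close>
  define b :: "real^3" where "b = vector [0, g1 v0 - e1 * v0, g2 v0 - e2 * v0]"
  have "e \<noteq> 0"
    using assms(9)[OF v0] by (auto simp: e_def e1_def e2_def vec_eq_iff forall_3)
  have \<beta>: "\<beta> v = b + v *\<^sub>R e" if "v \<in> J" for v
    using line[OF that, of g1 e1] line[OF that, of g2 e2] dg1 const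
    by (simp add: \<beta>_def b_def e_def vec_eq_iff forall_3 mult.commute)
  have "cylinder_with_ruling r (param_domain I J) e"
    unfolding cylinder_with_ruling_def
  proof (intro conjI exI)
    \<comment> \<open>The given parameters already rule the surface: v runs along the lines, and
      \<alpha> translated by \<open>b\<close> is the directrix. Hence the identity serves as
      reparameterization.\<close>
    show "homeomorphism (param_domain I J) (param_domain I J) (\<lambda>x. x) (\<lambda>x. x)"
      by (simp add: homeomorphism_ident)
    show "smooth_on I (\<lambda>u. \<alpha> u + b)"
      by (rule smooth_on_add_const[OF assms(6)])
    show "\<forall>q\<in>param_domain I J. r q = (\<alpha> (q $ 1) + b) + (q $ 2) *\<^sub>R e"
      by (auto simp: r_def translation_surface_def param_domain_def \<beta>)
  qed (simp_all add: assms \<open>e \<noteq> 0\<close> smooth_on_ident)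
  moreover have "isotropic e"
    by (simp add: isotropic_def e_def)
  ultimately show ?thesis
    using K0 by (auto simp: generalized_cylinder_isotropic_rulings_def)
qed

end
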